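(* Let $G$ be a torsion-free abelian group of finite rank, let $\tau$ be a type, and suppose that $H$ is a nonzero completely decomposable $\tau$-homogeneous fully invariant direct summand of $G$. Then every indecomposable decomposition of $G$ contains a rank-$1$ summand of type $\tau$.
   Context: Types are isomorphism classes of rank-one torsion-free abelian groups. A completely decomposable $\tau$-homogeneous group is a direct sum of rank-one groups all of type $\tau$. An indecomposable decomposition of $G$ is a direct decomposition $G=G_1\oplus\cdots\oplus G_t$ with each $G_i$ nonzero and indecomposable. A subgroup of $G$ is fully invariant if it is mapped into itself by every endomorphism of $G$. *)

theory Defs
  imports "HOL-Algebra.Algebra"
begin

text \<open>Abelian groups are multiplicatively written \<^locale>\<open>comm_group\<close>s; a subgroup \<open>A\<close> of \<open>G\<close>
  is regarded as the group \<open>G\<lparr>carrier := A\<rparr>\<close>.\<close>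

definition torsion_free :: "('a, 'b) monoid_scheme \<Rightarrow> bool" where
  "torsion_free G \<longleftrightarrow>
     (\<forall>x\<in>carrier G. \<forall>n::nat. 0 < n \<longrightarrow> x [^]\<^bsub>G\<^esub> n = \<one>\<^bsub>G\<^esub> \<longrightarrow> x = \<one>\<^bsub>G\<^esub>)"

definition independent_in :: "('a, 'b) monoid_scheme \<Rightarrow> 'a set \<Rightarrow> bool" where
  "independent_in G S \<longleftrightarrow> S \<subseteq> carrier G \<and>
     (\<forall>F c. finite F \<longrightarrow> F \<subseteq> S \<longrightarrow> (\<Otimes>\<^bsub>G\<^esub>x\<in>F. x [^]\<^bsub>G\<^esub> (c x :: int)) = \<one>\<^bsub>G\<^esub> \<longrightarrow>
        (\<forall>x\<in>F. c x = 0))"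

definition max_independent_in :: "('a, 'b) monoid_scheme \<Rightarrow> 'a set \<Rightarrow> bool" where
  "max_independent_in G S \<longleftrightarrow> independent_in G S \<and>
     (\<forall>Y. independent_in G Y \<longrightarrow> S \<subseteq> Y \<longrightarrow> Y = S)"

definition has_rank :: "('a, 'b) monoid_scheme \<Rightarrow> nat \<Rightarrow> bool" where
  "has_rank G n \<longleftrightarrow> (\<exists>S. max_independent_in G S \<and> finite S \<and> card S = n)"

definition finite_rank :: "('a, 'b) monoid_scheme \<Rightarrow> bool" where
  "finite_rank G \<longleftrightarrow> (\<exists>n. has_rank G n)"

definition rank_one_groups :: "('a, 'b) monoid_scheme set" where
  "rank_one_groups = {A. comm_group A \<and> torsion_free A \<and> has_rank A 1}"

text \<open>A type is an isomorphism class of rank-one torsion-free groups, and a group \<open>A\<close> has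
  type \<open>\<tau>\<close> if \<open>A \<in> \<tau>\<close>.  The classes consist of groups over a fixed HOL type \<open>'a\<close>; since rank-one
  groups are countable, every one of them has an isomorphic copy over any infinite \<open>'a\<close>.\<close>

definition group_types :: "('a, 'b) monoid_scheme set set" where
  "group_types =
     rank_one_groups // {(A, B). A \<in> rank_one_groups \<and> B \<in> rank_one_groups \<and> A \<cong> B}"

definition internal_direct_sum ::
    "('a, 'b) monoid_scheme \<Rightarrow> 'i set \<Rightarrow> ('i \<Rightarrow> 'a set) \<Rightarrow> bool" where
  "internal_direct_sum G I A \<longleftrightarrow>
     (\<forall>i\<in>I. subgroup (A i) G) \<and>
     generate G (\<Union>i\<in>I. A i) = carrier G \<and>
     (\<forall>i\<in>I. A i \<inter> generate G (\<Union>j\<in>I - {i}. A j) = {\<one>\<^bsub>G\<^esub>})"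

definition direct_sum2 :: "('a, 'b) monoid_scheme \<Rightarrow> 'a set \<Rightarrow> 'a set \<Rightarrow> bool" where
  "direct_sum2 G A B \<longleftrightarrow> subgroup A G \<and> subgroup B G \<and>
     A <#>\<^bsub>G\<^esub> B = carrier G \<and> A \<inter> B = {\<one>\<^bsub>G\<^esub>}"

definition direct_summand :: "'a set \<Rightarrow> ('a, 'b) monoid_scheme \<Rightarrow> bool" where
  "direct_summand H G \<longleftrightarrow> (\<exists>K. direct_sum2 G H K)"

definition fully_invariant :: "'a set \<Rightarrow> ('a, 'b) monoid_scheme \<Rightarrow> bool" where
  "fully_invariant H G \<longleftrightarrow> subgroup H G \<and> (\<forall>f\<in>hom G G. f ` H \<subseteq> H)"

text \<open>The family of summands is given as a set: no loss, since in a direct sum of nonzero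
  subgroups the summands at different indices are different.\<close>

definition completely_decomposable_homogeneous ::
    "('a, 'b) monoid_scheme set \<Rightarrow> ('a, 'b) monoid_scheme \<Rightarrow> bool" where
  "completely_decomposable_homogeneous \<tau> H \<longleftrightarrow>
     (\<exists>S. internal_direct_sum H S (\<lambda>A. A) \<and> (\<forall>A\<in>S. H\<lparr>carrier := A\<rparr> \<in> \<tau>))"

definition indecomposable :: "('a, 'b) monoid_scheme \<Rightarrow> bool" where
  "indecomposable G \<longleftrightarrow>
     (\<forall>A B. direct_sum2 G A B \<longrightarrow> A = {\<one>\<^bsub>G\<^esub>} \<or> B = {\<one>\<^bsub>G\<^esub>})"

definition indecomposable_decomposition ::
    "('a, 'b) monoid_scheme \<Rightarrow> nat \<Rightarrow> (nat \<Rightarrow> 'a set) \<Rightarrow> bool" where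
  "indecomposable_decomposition G t D \<longleftrightarrow> internal_direct_sum G {1..t} D \<and>
     (\<forall>i\<in>{1..t}. D i \<noteq> {\<one>\<^bsub>G\<^esub>} \<and> indecomposable (G\<lparr>carrier := D i\<rparr>))"

end

theory Submission imports Defs begin

text \<open>Full invariance makes every projection \<open>G \<rightarrow> D\<^sub>i\<close> map \<open>H\<close> into \<open>H \<inter> D\<^sub>i\<close>, so \<open>H \<inter> D\<^sub>i\<close> is a
  retract of the indecomposable group \<open>D\<^sub>i\<close>; being nonzero for some \<open>i\<close>, it is then all of \<open>D\<^sub>i\<close>.
  Such a \<open>D\<^sub>i\<close> is a nonzero pure subgroup of the homogeneous completely decomposable group \<open>H\<close>.
  The pure subgroup generated by any nonzero element of \<open>D\<^sub>i\<close> is a summand of \<open>H\<close> of type \<open>\<tau>\<close>,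
  because a vector of coprime integers is unimodular, and indecomposability forces it to be \<open>D\<^sub>i\<close>.\<close>

section \<open>Rank one expressed through integer powers\<close>

lemma (in group) torsion_free_int_pow:
  assumes "torsion_free G" "x \<in> carrier G" "x [^] (k::int) = \<one>" "k \<noteq> 0"
  shows "x = \<one>"
proof -
  have "x [^] (nat \<bar>k\<bar>) = \<one>"
  proof (cases "k \<ge> 0")
    case True
    then have "x [^] (nat \<bar>k\<bar>) = x [^] k" by (simp flip: int_pow_int)
    then show ?thesis using assms(3) by simp
  next
    case False
    then have "x [^] (nat \<bar>k\<bar>) = x [^] (- k)" by (simp flip: int_pow_int)
    also have "\<dots> = \<one>" using assms(2,3) by (simp add: int_pow_neg)
    finally show ?thesis .
  qed
  moreover have "0 < nat \<bar>k\<bar>" using assms(4) by simp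
  ultimately show ?thesis using assms(1,2) unfolding torsion_free_def by blast
qed

text \<open>Trades finite subsets and exponent functions for one relation in two integers. With
  \<open>x = a\<close> the set would collapse to a singleton while
  \<open>a [^] 1 \<otimes> x [^] (-1)\<close> is still trivial, hence
  \<open>x \<noteq> a\<close>.\<close>

lemma (in comm_group) independent_pair_iff:
  assumes "a \<in> carrier G" "x \<in> carrier G" "x \<noteq> a"
  shows "independent_in G {a, x} \<longleftrightarrow>
    (\<forall>(k::int) (m::int). a [^] k \<otimes> x [^] m = \<one> \<longrightarrow> k = 0 \<and> m = 0)"
proof
  assume ind: "independent_in G {a, x}"
  show "\<forall>(k::int) (m::int). a [^] k \<otimes> x [^] m = \<one> \<longrightarrow> k = 0 \<and> m = 0"
  proof (intro allI impI)
    fix k m :: int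
    assume e: "a [^] k \<otimes> x [^] m = \<one>"
    let ?c = "\<lambda>y. if y = a then k else m"
    have "(\<Otimes>y\<in>{a, x}. y [^] ?c y) = \<one>"
      using assms e by (subst finprod_insert) (auto simp: Pi_def)
    moreover have "finite {a, x}" by simp
    ultimately have "\<forall>y\<in>{a, x}. ?c y = 0"
      using ind[unfolded independent_in_def, THEN conjunct2, rule_format, of "{a, x}" ?c] by auto
    then show "k = 0 \<and> m = 0" using assms(3) by auto
  qed
next
  assume R: "\<forall>(k::int) (m::int). a [^] k \<otimes> x [^] m = \<one> \<longrightarrow> k = 0 \<and> m = 0"
  show "independent_in G {a, x}"
    unfolding independent_in_def
  proof (intro conjI allI impI)
    show "{a, x} \<subseteq> carrier G" using assms by auto
    fix F c
    assume F: "finite F" "F \<subseteq> {a, x}" and e: "(\<Otimes>y\<in>F. y [^] (c y :: int)) = \<one>"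
    \<comment> \<open>Padding the exponents with 0 outside \<open>F\<close> turns a relation over
      any subset \<open>F\<close> into a relation over the whole pair.\<close>
    let ?d = "\<lambda>y. if y \<in> F then c y else 0"
    have "(\<Otimes>y\<in>{a, x}. y [^] ?d y) = (\<Otimes>y\<in>F. y [^] (c y :: int))"
      using F assms by (intro finprod_mono_neutral_cong_right) (auto simp: Pi_def)
    then have "a [^] ?d a \<otimes> x [^] ?d x = \<one>"
      using assms e by (simp add: Pi_def)
    then have "?d a = 0 \<and> ?d x = 0" using R by blast
    then show "\<forall>y\<in>F. c y = 0" using F by fastforce
  qed
qed

lemma (in comm_group) independent_singleton_iff:
  assumes "torsion_free G" "a \<in> carrier G"
  shows "independent_in G {a} \<longleftrightarrow> a \<noteq> \<one>"
proof
  assume "independent_in G {a}"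
  \<comment> \<open>If \<open>a\<close> were the unit, the exponent 1 would give a nontrivial
    relation.\<close>
  from this[unfolded independent_in_def, THEN conjunct2, rule_format, of "{a}" "\<lambda>_. 1"]
  show "a \<noteq> \<one>" using assms by auto
next
  assume "a \<noteq> \<one>"
  then show "independent_in G {a}"
    unfolding independent_in_def subset_singleton_iff
    using assms(2) torsion_free_int_pow[OF assms] by fastforce
qed

text \<open>The working form of rank one. Maximality of \<open>{a}\<close> makes every other
  \<open>x\<close> dependent on \<open>a\<close>, and the exponent of \<open>x\<close> in the
  relation cannot vanish because \<open>a\<close> has infinite order. Conversely, such relations
  prevent \<open>{a}\<close> from being enlarged.\<close>

lemma (in comm_group) has_rank_one_iff:
  assumes "torsion_free G"
  shows "has_rank G 1 \<longleftrightarrow>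
    (\<exists>a\<in>carrier G. a \<noteq> \<one> \<and> (\<forall>x\<in>carrier G. \<exists>(m::int) (k::int). m \<noteq> 0 \<and> x [^] m = a [^] k))"
proof
  assume "has_rank G 1"
  then obtain a where max: "max_independent_in G {a}"
    unfolding has_rank_def by (metis card_1_singletonE)
  then have ind: "independent_in G {a}" by (simp add: max_independent_in_def)
  then have a: "a \<in> carrier G" by (simp add: independent_in_def)
  with ind assms have a1: "a \<noteq> \<one>" using independent_singleton_iff by blast
  have "\<exists>(m::int) (k::int). m \<noteq> 0 \<and> x [^] m = a [^] k" if x: "x \<in> carrier G" for x
  proof (cases "x = a")
    case True
    then show ?thesis by (intro exI[of _ 1]) auto
  next
    case False
    then have "\<not> independent_in G {a, x}"
      using max unfolding max_independent_in_def by blast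
    then obtain k m :: int where km: "a [^] k \<otimes> x [^] m = \<one>" "\<not> (k = 0 \<and> m = 0)"
      using independent_pair_iff[OF a x False] by blast
    have "m \<noteq> 0"
    proof
      assume "m = 0"
      then have "a [^] k = \<one>" "k \<noteq> 0" using km a by auto
      then show False using torsion_free_int_pow[OF assms a] a1 by blast
    qed
    moreover have "x [^] m = a [^] (- k)"
      using km(1) a x by (metis int_pow_closed int_pow_neg inv_equality inv_inv m_comm)
    ultimately show ?thesis by blast
  qed
  with a a1 show "\<exists>a\<in>carrier G. a \<noteq> \<one> \<and> (\<forall>x\<in>carrier G. \<exists>(m::int) (k::int). m \<noteq> 0 \<and> x [^] m = a [^] k)"
    by blast
next
  assume "\<exists>a\<in>carrier G. a \<noteq> \<one> \<and> (\<forall>x\<in>carrier G. \<exists>(m::int) (k::int). m \<noteq> 0 \<and> x [^] m = a [^] k)"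
  then obtain a where a: "a \<in> carrier G" "a \<noteq> \<one>"
    and gen: "\<And>x. x \<in> carrier G \<Longrightarrow> \<exists>(m::int) (k::int). m \<noteq> 0 \<and> x [^] m = a [^] k"
    by blast
  have "Y = {a}" if Y: "independent_in G Y" "{a} \<subseteq> Y" for Y
  proof (rule ccontr)
    assume "Y \<noteq> {a}"
    then obtain x where x: "x \<in> Y" "x \<noteq> a" using Y by auto
    then have xc: "x \<in> carrier G" using Y unfolding independent_in_def by blast
    have "independent_in G {a, x}"
      using Y x unfolding independent_in_def by (metis (no_types, lifting) bot_least insert_subset subset_trans)
    moreover obtain m k :: int where mk: "m \<noteq> 0" "x [^] m = a [^] k" using gen[OF xc] by blast
    moreover have "a [^] (- k) \<otimes> x [^] m = \<one>"
      using mk a by (simp add: int_pow_neg)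
    ultimately show False using independent_pair_iff[OF a(1) xc x(2)] by blast
  qed
  then have "max_independent_in G {a}"
    using a assms independent_singleton_iff by (auto simp: max_independent_in_def)
  then show "has_rank G 1" unfolding has_rank_def by (intro exI[of _ "{a}"]) auto
qed

section \<open>Homomorphisms and finite products\<close>

text \<open>For infinite \<open>F\<close> both products are the unit by the convention on
  \<open>finprod\<close>, and \<open>h\<close> preserves the unit.\<close>

lemma hom_finprod:
  assumes "comm_group G" "comm_group K" "h \<in> hom G K" "f \<in> F \<rightarrow> carrier G"
  shows "h (finprod G f F) = finprod K (\<lambda>i. h (f i)) F"
proof -
  interpret G: comm_group G by fact
  interpret K: comm_group K by fact
  interpret group_hom G K h by unfold_locales (fact assms)
  show ?thesis using assms(4)
  proof (induction F rule: infinite_finite_induct)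
    case (insert x F)
    then have "(\<lambda>i. h (f i)) \<in> F \<rightarrow> carrier K" by (auto simp: Pi_iff)
    then show ?case using insert by (simp add: Pi_def)
  qed auto
qed

lemma (in comm_group) hom_pow: "(\<lambda>x. x [^] (k::int)) \<in> hom G G"
  by (rule homI) (auto simp: int_pow_distrib)

lemma (in comm_group) finprod_int_pow:
  assumes "f \<in> F \<rightarrow> carrier G"
  shows "(\<Otimes>i\<in>F. f i) [^] (k::int) = (\<Otimes>i\<in>F. f i [^] k)"
  using hom_finprod[OF comm_group_axioms comm_group_axioms hom_pow assms] .

lemma (in comm_group) finprod_int_pow_exponents:
  assumes "x \<in> carrier G" "finite F"
  shows "(\<Otimes>i\<in>F. x [^] (k i :: int)) = x [^] (\<Sum>i\<in>F. k i)"
  using assms(2) by induction (auto simp: assms(1) int_pow_mult Pi_def)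

text \<open>Homomorphisms into an abelian group are closed under integer linear combinations; this
  is how the retraction pair \<open>f\<close>, \<open>g\<close> for a rank-one group is built
  later.\<close>

lemma (in comm_group) finprod_pow_in_hom:
  assumes "group A" "\<And>i. i \<in> F \<Longrightarrow> f i \<in> hom A G"
  shows "(\<lambda>x. \<Otimes>i\<in>F. f i x [^] (k i :: int)) \<in> hom A G"
proof (rule homI)
  have c: "f i x \<in> carrier G" if "i \<in> F" "x \<in> carrier A" for i x
    using assms that by (meson hom_in_carrier)
  fix x assume x: "x \<in> carrier A"
  show "(\<Otimes>i\<in>F. f i x [^] k i) \<in> carrier G" using c x by (auto intro!: finprod_closed)
  fix y assume y: "y \<in> carrier A"
  have "(\<Otimes>i\<in>F. f i (x \<otimes>\<^bsub>A\<^esub> y) [^] k i) = (\<Otimes>i\<in>F. f i x [^] k i \<otimes> f i y [^] k i)"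
    using c x y by (intro finprod_cong') (auto simp: hom_mult[OF assms(2)] int_pow_distrib)
  also have "\<dots> = (\<Otimes>i\<in>F. f i x [^] k i) \<otimes> (\<Otimes>i\<in>F. f i y [^] k i)"
    using c x y by (intro finprod_multf) auto
  finally show "(\<Otimes>i\<in>F. f i (x \<otimes>\<^bsub>A\<^esub> y) [^] k i)
    = (\<Otimes>i\<in>F. f i x [^] k i) \<otimes> (\<Otimes>i\<in>F. f i y [^] k i)" .
qed

section \<open>Retracts as direct summands\<close>

lemma (in comm_group) subgroup_is_comm_group:
  assumes "subgroup H G"
  shows "comm_group (G\<lparr>carrier := H\<rparr>)"
proof -
  interpret H: subgroup H G by fact
  show ?thesis
    using subgroup_imp_group[OF assms] by (rule group.group_comm_groupI) (simp add: m_comm)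
qed

text \<open>Every \<open>x\<close> splits as \<open>f (g x)\<close> times a remainder that
  \<open>g\<close> kills, and \<open>g\<close> is injective on the image of
  \<open>f\<close>.\<close>

lemma retract_direct_sum2:
  assumes "comm_group C" "group A" "f \<in> hom A C" "g \<in> hom C A"
    and gf: "\<And>x. x \<in> carrier A \<Longrightarrow> g (f x) = x"
  shows "direct_sum2 C (f ` carrier A) (kernel C A g)"
proof -
  interpret C: comm_group C by fact
  interpret A: group A by fact
  interpret f: group_hom A C f by unfold_locales (fact assms)
  interpret g: group_hom C A g by unfold_locales (fact assms)
  have "x \<in> f ` carrier A <#>\<^bsub>C\<^esub> kernel C A g" if x: "x \<in> carrier C" for x
  proof -
    let ?z = "inv\<^bsub>C\<^esub> (f (g x)) \<otimes>\<^bsub>C\<^esub> x"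
    have "?z \<in> kernel C A g" using x by (simp add: kernel_def gf)
    moreover have "x = f (g x) \<otimes>\<^bsub>C\<^esub> ?z" using x by (simp flip: C.m_assoc)
    moreover have "f (g x) \<in> f ` carrier A" using x by simp
    ultimately show ?thesis unfolding set_mult_def by (intro UN_I) auto
  qed
  moreover have "x = \<one>\<^bsub>C\<^esub>" if "x \<in> f ` carrier A" "x \<in> kernel C A g" for x
    using that gf by (auto simp: kernel_def)
  moreover have "f ` carrier A <#>\<^bsub>C\<^esub> kernel C A g \<subseteq> carrier C"
    by (intro C.set_mult_closed f.img_is_subgroup[THEN subgroup.subset]
        g.subgroup_kernel[THEN subgroup.subset])
  moreover have "\<one>\<^bsub>C\<^esub> \<in> f ` carrier A \<inter> kernel C A g"
    using f.img_is_subgroup g.subgroup_kernel by (simp add: subgroup.one_closed)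
  ultimately have "f ` carrier A <#>\<^bsub>C\<^esub> kernel C A g = carrier C"
    "f ` carrier A \<inter> kernel C A g = {\<one>\<^bsub>C\<^esub>}"
    by blast+
  then show ?thesis
    unfolding direct_sum2_def using f.img_is_subgroup g.subgroup_kernel by blast
qed

text \<open>The image of \<open>f\<close> is a nontrivial summand of \<open>C\<close>, so its
  complement, the kernel of \<open>g\<close>, is trivial. Then \<open>g\<close> is injective, and
  \<open>g (f (g x)) = g x\<close> yields \<open>f (g x) = x\<close>. The lemma is applied both to
  an intersection \<open>H \<inter> D i\<close> inside \<open>D i\<close> and to a rank-one group
  mapped into a pure subgroup.\<close>

lemma indecomposable_retract_iso:
  assumes "comm_group C" "indecomposable C" "group A" "carrier A \<noteq> {\<one>\<^bsub>A\<^esub>}"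
    and "f \<in> hom A C" "g \<in> hom C A"
    and gf: "\<And>x. x \<in> carrier A \<Longrightarrow> g (f x) = x"
  shows "f \<in> iso A C"
proof -
  interpret C: comm_group C by fact
  interpret A: group A by fact
  interpret f: group_hom A C f by unfold_locales (fact assms)
  interpret g: group_hom C A g by unfold_locales (fact assms)
  have ds: "direct_sum2 C (f ` carrier A) (kernel C A g)"
    using retract_direct_sum2 assms by blast
  have "f ` carrier A \<noteq> {\<one>\<^bsub>C\<^esub>}"
  proof
    assume "f ` carrier A = {\<one>\<^bsub>C\<^esub>}"
    then have "x = \<one>\<^bsub>A\<^esub>" if "x \<in> carrier A" for x
      using that gf by (metis g.hom_one image_eqI singletonD)
    then show False using assms(4) A.one_closed by blast
  qed
  then have "kernel C A g = {\<one>\<^bsub>C\<^esub>}"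
    using ds assms(2) unfolding indecomposable_def by blast
  then have "inj_on g (carrier C)" by (simp add: g.inj_iff_trivial_ker)
  then have "f (g x) = x" if "x \<in> carrier C" for x
    using that gf by (meson f.hom_closed g.hom_closed inj_onD)
  then have "bij_betw f (carrier A) (carrier C)"
    using gf by (intro bij_betw_byWitness[where f' = g]) auto
  then show ?thesis using assms(5) by (simp add: iso_def)
qed

section \<open>Projections of direct decompositions\<close>

lemma direct_sum2_projection:
  fixes G (structure)
  assumes "comm_group G" "direct_sum2 G A B"
  obtains p where "p \<in> hom G (G\<lparr>carrier := A\<rparr>)"
    "\<And>x. x \<in> A \<Longrightarrow> p x = x" "\<And>x. x \<in> B \<Longrightarrow> p x = \<one>\<^bsub>G\<^esub>"
proof -
  interpret comm_group G by fact
  have sub: "subgroup A G" "subgroup B G" and prod: "A <#> B = carrier G" and int: "A \<inter> B = {\<one>}"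
    using assms(2) by (auto simp: direct_sum2_def)
  interpret A: subgroup A G by fact
  interpret B: subgroup B G by fact
  have ex: "\<exists>a\<in>A. \<exists>b\<in>B. x = a \<otimes> b" if "x \<in> carrier G" for x
    using that unfolding prod[symmetric] by (auto simp: set_mult_def)
  have uniq: "a = a'" if "a \<in> A" "b \<in> B" "a' \<in> A" "b' \<in> B" "a \<otimes> b = a' \<otimes> b'" for a b a' b'
  proof -
    have "inv a' \<otimes> a = b' \<otimes> inv b"
      using that A.subset B.subset
      by (metis A.mem_carrier B.mem_carrier inv_closed inv_solve_left inv_solve_right m_assoc m_closed)
    then have "inv a' \<otimes> a \<in> A \<inter> B" using that by (metis A.m_closed A.m_inv_closed B.m_closed B.m_inv_closed IntI)
    then have "inv a' \<otimes> a = \<one>" using int by blast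
    then show ?thesis using that by (metis A.mem_carrier inv_closed inv_equality inv_inv)
  qed
  \<comment> \<open>The component in \<open>A\<close>; the description is well defined by
    \<open>uniq\<close>, since two decompositions differ by an element of
    \<open>A \<inter> B\<close>.\<close>
  define p where "p x = (THE a. a \<in> A \<and> (\<exists>b\<in>B. x = a \<otimes> b))" for x
  have p: "p (a \<otimes> b) = a" if "a \<in> A" "b \<in> B" for a b
    unfolding p_def using that uniq by (intro the_equality) blast+
  show ?thesis
  proof
    show "p x = x" if "x \<in> A" for x using p[OF that B.one_closed] that by simp
    show "p x = \<one>" if "x \<in> B" for x using p[OF A.one_closed that] that by simp
    show "p \<in> hom G (G\<lparr>carrier := A\<rparr>)"
    proof (rule homI)
      fix x assume "x \<in> carrier G"
      then obtain a b where ab: "a \<in> A" "b \<in> B" "x = a \<otimes> b" using ex by blast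
      then show "p x \<in> carrier (G\<lparr>carrier := A\<rparr>)" using p by simp
      fix y assume "y \<in> carrier G"
      then obtain c d where cd: "c \<in> A" "d \<in> B" "y = c \<otimes> d" using ex by blast
      have "x \<otimes> y = (a \<otimes> c) \<otimes> (b \<otimes> d)" using ab cd by (simp add: m_ac)
      then show "p (x \<otimes> y) = p x \<otimes>\<^bsub>G\<lparr>carrier := A\<rparr>\<^esub> p y" using ab cd p by simp
    qed
  qed
qed

text \<open>The product of \<open>A i\<close> and the complement is a subgroup containing every
  \<open>A j\<close>, hence everything they generate.\<close>

lemma internal_direct_sum_direct_sum2:
  fixes G (structure)
  assumes "comm_group G" "internal_direct_sum G I A" "i \<in> I"
  shows "direct_sum2 G (A i) (generate G (\<Union>j\<in>I - {i}. A j))"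
proof -
  interpret comm_group G by fact
  let ?B = "generate G (\<Union>j\<in>I - {i}. A j)"
  have sub: "\<And>j. j \<in> I \<Longrightarrow> subgroup (A j) G" and gen: "generate G (\<Union>j\<in>I. A j) = carrier G"
    and int: "A i \<inter> ?B = {\<one>}"
    using assms(2,3) by (auto simp: internal_direct_sum_def)
  have Asub: "A j \<subseteq> carrier G" if "j \<in> I" for j using sub[OF that] by (rule subgroup.subset)
  have B: "subgroup ?B G" using Asub by (intro generate_is_subgroup) auto
  have "subgroup (A i <#> ?B) G"
    using sub[OF assms(3)] B by (intro mult_subgroups)
  moreover have "A j \<subseteq> A i <#> ?B" if "j \<in> I" for j
  proof
    fix x assume x: "x \<in> A j"
    show "x \<in> A i <#> ?B"
    proof (cases "j = i")
      case True
      then have "x \<otimes> \<one> \<in> A i <#> ?B"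
        using x subgroup.one_closed[OF B] by (auto simp: set_mult_def)
      then show ?thesis using x Asub[OF that] by auto
    next
      case False
      then have "x \<in> ?B" using x that by (intro generate.incl) auto
      then have "\<one> \<otimes> x \<in> A i <#> ?B"
        using subgroup.one_closed[OF sub[OF assms(3)]] by (auto simp: set_mult_def)
      then show ?thesis using x Asub[OF that] by auto
    qed
  qed
  ultimately have "carrier G \<subseteq> A i <#> ?B"
    unfolding gen[symmetric] by (intro generate_subgroup_incl) auto
  moreover have "A i <#> ?B \<subseteq> carrier G"
    using Asub[OF assms(3)] subgroup.subset[OF B] by (rule set_mult_closed)
  ultimately show ?thesis using sub[OF assms(3)] B int by (auto simp: direct_sum2_def)
qed

text \<open>Since \<open>I\<close> may be infinite, the reconstruction of \<open>x\<close> from its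
  components is stated with a finite \<open>F\<close> depending on \<open>x\<close>.\<close>

lemma internal_direct_sum_projections:
  fixes G (structure)
  assumes "comm_group G" "internal_direct_sum G I A"
  obtains p where "\<And>i. i \<in> I \<Longrightarrow> p i \<in> hom G (G\<lparr>carrier := A i\<rparr>)"
    "\<And>i x. i \<in> I \<Longrightarrow> x \<in> A i \<Longrightarrow> p i x = x"
    "\<And>i j x. i \<in> I \<Longrightarrow> j \<in> I \<Longrightarrow> i \<noteq> j \<Longrightarrow> x \<in> A j \<Longrightarrow> p i x = \<one>\<^bsub>G\<^esub>"
    "\<And>x. x \<in> carrier G \<Longrightarrow> \<exists>F. finite F \<and> F \<subseteq> I \<and> x = (\<Otimes>\<^bsub>G\<^esub>i\<in>F. p i x)"
proof -
  interpret comm_group G by fact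
  have "\<exists>p. p \<in> hom G (G\<lparr>carrier := A i\<rparr>) \<and> (\<forall>x\<in>A i. p x = x)
    \<and> (\<forall>x\<in>generate G (\<Union>j\<in>I - {i}. A j). p x = \<one>)" if "i \<in> I" for i
    using direct_sum2_projection[OF assms(1) internal_direct_sum_direct_sum2[OF assms that]]
    by metis
  then obtain p where p: "\<And>i. i \<in> I \<Longrightarrow> p i \<in> hom G (G\<lparr>carrier := A i\<rparr>)"
    "\<And>i x. i \<in> I \<Longrightarrow> x \<in> A i \<Longrightarrow> p i x = x"
    and p1: "\<And>i x. i \<in> I \<Longrightarrow> x \<in> generate G (\<Union>j\<in>I - {i}. A j) \<Longrightarrow> p i x = \<one>"
    by metis
  have p0: "p i x = \<one>" if "i \<in> I" "j \<in> I" "i \<noteq> j" "x \<in> A j" for i j x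
    using that by (intro p1 generate.incl) auto
  have sub: "\<And>j. j \<in> I \<Longrightarrow> subgroup (A j) G" and gen: "generate G (\<Union>j\<in>I. A j) = carrier G"
    using assms(2) by (auto simp: internal_direct_sum_def)
  have Asub: "x \<in> carrier G" if "j \<in> I" "x \<in> A j" for j x
    using sub[OF that(1)] that(2) by (rule subgroup.mem_carrier)
  have pc: "p i x \<in> carrier G" if "i \<in> I" "x \<in> carrier G" for i x
    using hom_in_carrier[OF p(1)[OF that(1)] that(2)] Asub that(1) by simp
  have pm: "p i (x \<otimes> y) = p i x \<otimes> p i y" if "i \<in> I" "x \<in> carrier G" "y \<in> carrier G" for i x y
    using hom_mult[OF p(1)] that by fastforce
  \<comment> \<open>The induction carries the extra clause that components outside \<open>F\<close>
    vanish. It allows the sets of two factors to be enlarged to their union without changing either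
    product.\<close>
  have single: "\<exists>F. finite F \<and> F \<subseteq> I \<and> (\<forall>i\<in>I - F. p i x = \<one>) \<and> x = (\<Otimes>i\<in>F. p i x)"
    if "j \<in> I" "x \<in> A j" for j x
    using that p(2) p0 Asub by (intro exI[of _ "{j}"]) auto
  have "\<exists>F. finite F \<and> F \<subseteq> I \<and> (\<forall>i\<in>I - F. p i x = \<one>) \<and> x = (\<Otimes>i\<in>F. p i x)"
    if "x \<in> generate G (\<Union>j\<in>I. A j)" for x
    using that
  proof induction
    case one
    have "p i \<one> = \<one>" if "i \<in> I" for i
      using p(2)[OF that] subgroup.one_closed[OF sub[OF that]] by blast
    then show ?case by (intro exI[of _ "{}"]) auto
  next
    case (incl h)
    then show ?case using single by blast
  next
    case (inv h)
    then show ?case using single subgroup.m_inv_closed[OF sub] by blast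
  next
    case (eng x y)
    then have xy: "x \<in> carrier G" "y \<in> carrier G" using gen by auto
    obtain F F' where
      F: "finite F" "F \<subseteq> I" "\<forall>i\<in>I - F. p i x = \<one>" "x = (\<Otimes>i\<in>F. p i x)" and
      F': "finite F'" "F' \<subseteq> I" "\<forall>i\<in>I - F'. p i y = \<one>" "y = (\<Otimes>i\<in>F'. p i y)"
      using eng.IH by blast
    have "(\<Otimes>i\<in>F. p i x) = (\<Otimes>i\<in>F \<union> F'. p i x)"
      using F F' pc xy by (intro finprod_mono_neutral_cong_left) (auto simp: Pi_def)
    moreover have "(\<Otimes>i\<in>F'. p i y) = (\<Otimes>i\<in>F \<union> F'. p i y)"
      using F F' pc xy by (intro finprod_mono_neutral_cong_left) (auto simp: Pi_def)
    ultimately have "x \<otimes> y = (\<Otimes>i\<in>F \<union> F'. p i x) \<otimes> (\<Otimes>i\<in>F \<union> F'. p i y)"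
      using F(4) F'(4) by simp
    also have "\<dots> = (\<Otimes>i\<in>F \<union> F'. p i x \<otimes> p i y)"
      using F(2) F'(2) pc xy by (intro finprod_multf[symmetric]) auto
    also have "\<dots> = (\<Otimes>i\<in>F \<union> F'. p i (x \<otimes> y))"
      using F(2) F'(2) pc pm xy by (intro finprod_cong') auto
    finally show ?case
      using F F' pm xy by (intro exI[of _ "F \<union> F'"]) auto
  qed
  then show thesis using that[of p] p p0 gen by metis
qed

section \<open>Bezout coefficients and rank-one retracts\<close>

text \<open>Two-term Bezout, iterated: adding \<open>x\<close> scales the old coefficients by
  \<open>b\<close> and gives \<open>x\<close> the coefficient \<open>a\<close>.\<close>

lemma Gcd_int_bezout:
  fixes K :: "'i \<Rightarrow> int"
  assumes "finite F"
  shows "\<exists>u. (\<Sum>i\<in>F. u i * K i) = Gcd (K ` F)"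
  using assms
proof induction
  case (insert x F)
  then obtain u where u: "(\<Sum>i\<in>F. u i * K i) = Gcd (K ` F)" by blast
  obtain a b where "a * K x + b * Gcd (K ` F) = gcd (K x) (Gcd (K ` F))"
    using bezout_int by blast
  moreover have "(\<Sum>i\<in>F. (if i = x then a else b * u i) * K i) = (\<Sum>i\<in>F. b * (u i * K i))"
    using insert.hyps by (intro sum.cong) auto
  ultimately show ?case
    using insert.hyps u
    by (intro exI[of _ "\<lambda>i. if i = x then a else b * u i"]) (simp flip: sum_distrib_left)
qed auto

text \<open>Identify \<open>A\<close> with a subgroup of the rationals containing \<open>a = 1\<close>.  Then \<open>c\<close> is a rational
  multiple of a vector \<open>q\<close> of coprime integers; \<open>f\<close> is \<open>x \<mapsto> x q\<close>, and \<open>g\<close> is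
  \<open>v \<mapsto> \<Sum> u\<^sub>i v\<^sub>i\<close> for Bezout coefficients \<open>u\<close> of \<open>q\<close>.\<close>

lemma rank_one_retract_through:
  assumes "comm_group H" "torsion_free H" "comm_group A"
    and a: "a \<in> carrier A" "\<And>x. x \<in> carrier A \<Longrightarrow> \<exists>(m::int) (k::int). m \<noteq> 0 \<and> x [^]\<^bsub>A\<^esub> m = a [^]\<^bsub>A\<^esub> k"
    and F: "finite F"
    and \<phi>: "\<And>i. i \<in> F \<Longrightarrow> \<phi> i \<in> hom A H"
    and \<psi>: "\<And>i. i \<in> F \<Longrightarrow> \<psi> i \<in> hom H A"
    and diag: "\<And>i x. i \<in> F \<Longrightarrow> x \<in> carrier A \<Longrightarrow> \<psi> i (\<phi> i x) = x"
    and offdiag: "\<And>i j x. i \<in> F \<Longrightarrow> j \<in> F \<Longrightarrow> i \<noteq> j \<Longrightarrow> x \<in> carrier A \<Longrightarrow> \<psi> i (\<phi> j x) = \<one>\<^bsub>A\<^esub>"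
    and c: "c \<in> carrier H" "c \<noteq> \<one>\<^bsub>H\<^esub>" "c = (\<Otimes>\<^bsub>H\<^esub>i\<in>F. \<phi> i (\<psi> i c))"
  obtains f g and M d :: int where "f \<in> hom A H" "g \<in> hom H A"
    "\<And>x. x \<in> carrier A \<Longrightarrow> g (f x) = x" "M \<noteq> 0" "d \<noteq> 0"
    "c [^]\<^bsub>H\<^esub> M = f a [^]\<^bsub>H\<^esub> d"
proof -
  interpret H: comm_group H by fact
  interpret A: comm_group A by fact
  have \<psi>c: "\<psi> i x \<in> carrier A" if "i \<in> F" "x \<in> carrier H" for i x
    using hom_in_carrier[OF \<psi>] that by blast
  have \<phi>c: "\<phi> i x \<in> carrier H" if "i \<in> F" "x \<in> carrier A" for i x
    using hom_in_carrier[OF \<phi>] that by blast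
  have \<phi>pow: "\<phi> i (x [^]\<^bsub>A\<^esub> (k::int)) = \<phi> i x [^]\<^bsub>H\<^esub> k" if "i \<in> F" "x \<in> carrier A" for i x k
    using hom_int_pow[OF \<phi> that(2) A.is_group H.is_group] that by blast
  have \<psi>pow: "\<psi> i (x [^]\<^bsub>H\<^esub> (k::int)) = \<psi> i x [^]\<^bsub>A\<^esub> k" if "i \<in> F" "x \<in> carrier H" for i x k
    using hom_int_pow[OF \<psi> that(2) H.is_group A.is_group] that by blast
  have "\<exists>(m::int) (k::int). m \<noteq> 0 \<and> \<psi> i c [^]\<^bsub>A\<^esub> m = a [^]\<^bsub>A\<^esub> k" if "i \<in> F" for i
    using a(2) \<psi>c that c(1) by blast
  then obtain m k :: "'e \<Rightarrow> int" where m: "\<And>i. i \<in> F \<Longrightarrow> m i \<noteq> 0"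
    and k: "\<And>i. i \<in> F \<Longrightarrow> \<psi> i c [^]\<^bsub>A\<^esub> m i = a [^]\<^bsub>A\<^esub> k i"
    by metis
  \<comment> \<open>Clearing denominators: \<open>M\<close> is one exponent that serves all
    coordinates, and \<open>K i\<close> is the integer coordinate of \<open>\<psi> i c [^] M\<close>
    with respect to \<open>a\<close>.\<close>
  define M where "M = (\<Prod>i\<in>F. m i)"
  define K where "K i = k i * (\<Prod>j\<in>F - {i}. m j)" for i
  have M0: "M \<noteq> 0" using m F by (simp add: M_def)
  have K: "\<psi> i c [^]\<^bsub>A\<^esub> M = a [^]\<^bsub>A\<^esub> K i" if "i \<in> F" for i
  proof -
    have "M = m i * (\<Prod>j\<in>F - {i}. m j)" unfolding M_def using F that by (rule prod.remove)
    then have "\<psi> i c [^]\<^bsub>A\<^esub> M = (\<psi> i c [^]\<^bsub>A\<^esub> m i) [^]\<^bsub>A\<^esub> (\<Prod>j\<in>F - {i}. m j)"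
      using that c(1) \<psi>c by (simp add: A.int_pow_pow)
    then show ?thesis using k[OF that] a(1) by (simp add: A.int_pow_pow K_def)
  qed
  have "c [^]\<^bsub>H\<^esub> M = (\<Otimes>\<^bsub>H\<^esub>i\<in>F. \<phi> i (\<psi> i c)) [^]\<^bsub>H\<^esub> M" using c(3) by simp
  also have "\<dots> = (\<Otimes>\<^bsub>H\<^esub>i\<in>F. \<phi> i (\<psi> i c) [^]\<^bsub>H\<^esub> M)"
    using \<phi>c \<psi>c c(1) by (intro H.finprod_int_pow) auto
  also have "\<dots> = (\<Otimes>\<^bsub>H\<^esub>i\<in>F. \<phi> i a [^]\<^bsub>H\<^esub> K i)"
    using \<phi>c \<psi>c c(1) a(1) K
    by (intro H.finprod_cong') (auto simp flip: \<phi>pow)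
  finally have cM: "c [^]\<^bsub>H\<^esub> M = (\<Otimes>\<^bsub>H\<^esub>i\<in>F. \<phi> i a [^]\<^bsub>H\<^esub> K i)" .
  define d where "d = Gcd (K ` F)"
  \<comment> \<open>A zero gcd would make every coordinate of \<open>c [^] M\<close> trivial,
    against torsion-freeness and \<open>c\<close> being nontrivial.\<close>
  have d0: "d \<noteq> 0"
  proof
    assume "d = 0"
    then have "K i = 0" if "i \<in> F" for i using that by (auto simp: d_def Gcd_0_iff)
    then have "c [^]\<^bsub>H\<^esub> M = \<one>\<^bsub>H\<^esub>" unfolding cM by (intro H.finprod_one_eqI) auto
    then show False using H.torsion_free_int_pow assms(2) c(1,2) M0 by blast
  qed
  define q where "q i = K i div d" for i
  have q: "K i = q i * d" if "i \<in> F" for i using that by (simp add: q_def d_def)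
  \<comment> \<open>Cancelling \<open>d\<close> from the Bezout identity shows that the vector
    \<open>q\<close> is unimodular, with the same coefficients \<open>u\<close>.\<close>
  obtain u where "(\<Sum>i\<in>F. u i * K i) = d" using Gcd_int_bezout[OF F] unfolding d_def by blast
  moreover have "(\<Sum>i\<in>F. u i * K i) = (\<Sum>i\<in>F. q i * u i) * d"
    unfolding sum_distrib_right by (intro sum.cong) (auto simp: q)
  ultimately have qu: "(\<Sum>i\<in>F. q i * u i) = 1" using d0 by simp
  define f where "f x = (\<Otimes>\<^bsub>H\<^esub>i\<in>F. \<phi> i x [^]\<^bsub>H\<^esub> q i)" for x
  define g where "g y = (\<Otimes>\<^bsub>A\<^esub>i\<in>F. \<psi> i y [^]\<^bsub>A\<^esub> u i)" for y
  have f: "f \<in> hom A H"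
    unfolding f_def using \<phi> by (intro H.finprod_pow_in_hom A.is_group)
  have g: "g \<in> hom H A"
    unfolding g_def using \<psi> by (intro A.finprod_pow_in_hom H.is_group)
  have gf: "g (f x) = x" if x: "x \<in> carrier A" for x
  proof -
    \<comment> \<open>\<open>\<psi> i\<close> reads off the coordinate at \<open>i\<close>: by
      \<open>offdiag\<close> every other factor is trivial.\<close>
    have \<psi>f: "\<psi> i (f x) = x [^]\<^bsub>A\<^esub> q i" if i: "i \<in> F" for i
    proof -
      have "\<psi> i (f x) = (\<Otimes>\<^bsub>A\<^esub>j\<in>F. \<psi> i (\<phi> j x [^]\<^bsub>H\<^esub> q j))"
        unfolding f_def using \<phi>c x
        by (intro hom_finprod[OF assms(1,3) \<psi>[OF i]]) auto
      also have "\<dots> = (\<Otimes>\<^bsub>A\<^esub>j\<in>F. if i = j then x [^]\<^bsub>A\<^esub> q j else \<one>\<^bsub>A\<^esub>)"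
        using \<phi>c x i by (intro A.finprod_cong') (auto simp: \<psi>pow diag offdiag)
      also have "\<dots> = x [^]\<^bsub>A\<^esub> q i" using x by (intro A.finprod_singleton i F) auto
      finally show ?thesis .
    qed
    have "g (f x) = (\<Otimes>\<^bsub>A\<^esub>i\<in>F. x [^]\<^bsub>A\<^esub> (q i * u i))"
      unfolding g_def using x by (intro A.finprod_cong') (auto simp: \<psi>f A.int_pow_pow)
    also have "\<dots> = x" using x F qu by (simp add: A.finprod_int_pow_exponents)
    finally show ?thesis .
  qed
  have "f a [^]\<^bsub>H\<^esub> d = (\<Otimes>\<^bsub>H\<^esub>i\<in>F. (\<phi> i a [^]\<^bsub>H\<^esub> q i) [^]\<^bsub>H\<^esub> d)"
    unfolding f_def using \<phi>c a(1) by (intro H.finprod_int_pow) auto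
  also have "\<dots> = c [^]\<^bsub>H\<^esub> M"
    unfolding cM using \<phi>c a(1) by (intro H.finprod_cong') (auto simp: H.int_pow_pow q)
  finally show thesis using that[OF f g gf M0 d0] by simp
qed

section \<open>Types as equivalence classes of rank-one groups\<close>

lemma equiv_rank_one_iso:
  "equiv rank_one_groups {(A, B). A \<in> rank_one_groups \<and> B \<in> rank_one_groups \<and> A \<cong> B}"
  by (intro equivI refl_onI symI transI)
    (auto simp: rank_one_groups_def comm_group_def iso_refl intro: group.iso_sym iso_trans)

lemma group_type_rank_one:
  assumes "\<tau> \<in> group_types" "A \<in> \<tau>"
  shows "A \<in> rank_one_groups"
  using assms in_quotient_imp_subset[OF equiv_rank_one_iso] unfolding group_types_def by blast

lemma group_type_iso:
  assumes "\<tau> \<in> group_types" "A \<in> \<tau>" "B \<in> \<tau>"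
  shows "A \<cong> B"
  using quotient_eq_iff[OF equiv_rank_one_iso assms(1)[unfolded group_types_def]
      assms(1)[unfolded group_types_def] assms(2,3)] by auto

lemma group_type_closed:
  assumes "\<tau> \<in> group_types" "A \<in> \<tau>" "B \<in> rank_one_groups" "A \<cong> B"
  shows "B \<in> \<tau>"
  using in_quotient_imp_closed[OF equiv_rank_one_iso assms(1)[unfolded group_types_def] assms(2)]
    group_type_rank_one[OF assms(1,2)] assms(3,4) by blast

text \<open>The image of a witness for \<open>has_rank_one_iff\<close> is again a witness: it is
  nontrivial by injectivity, and the power relations are carried over by \<open>f\<close>.\<close>

lemma iso_rank_one:
  assumes "A \<in> rank_one_groups" "comm_group C" "torsion_free C" "f \<in> iso A C"
  shows "C \<in> rank_one_groups"
proof -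
  interpret C: comm_group C by fact
  interpret A: comm_group A using assms(1) by (simp add: rank_one_groups_def)
  interpret f: group_hom A C f using assms(4) by unfold_locales (simp add: iso_def)
  have bij: "bij_betw f (carrier A) (carrier C)" using assms(4) by (simp add: iso_def)
  obtain a where a: "a \<in> carrier A" "a \<noteq> \<one>\<^bsub>A\<^esub>"
    and gen: "\<And>x. x \<in> carrier A \<Longrightarrow> \<exists>(m::int) (k::int). m \<noteq> 0 \<and> x [^]\<^bsub>A\<^esub> m = a [^]\<^bsub>A\<^esub> k"
    using assms(1) A.has_rank_one_iff unfolding rank_one_groups_def by blast
  have "f a \<noteq> \<one>\<^bsub>C\<^esub>"
    using a bij by (metis A.one_closed bij_betw_imp_inj_on f.hom_one inj_onD)
  moreover have "\<exists>(m::int) (k::int). m \<noteq> 0 \<and> y [^]\<^bsub>C\<^esub> m = f a [^]\<^bsub>C\<^esub> k"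
    if y: "y \<in> carrier C" for y
  proof -
    obtain x where x: "x \<in> carrier A" "y = f x" using y bij_betw_imp_surj_on[OF bij] by blast
    obtain m k :: int where mk: "m \<noteq> 0" "x [^]\<^bsub>A\<^esub> m = a [^]\<^bsub>A\<^esub> k"
      using gen[OF x(1)] by blast
    have "y [^]\<^bsub>C\<^esub> m = f a [^]\<^bsub>C\<^esub> k" using mk(2) x a(1) by (simp flip: f.hom_int_pow)
    then show ?thesis using mk(1) by blast
  qed
  ultimately have "has_rank C 1"
    using f.hom_closed[OF a(1)] unfolding C.has_rank_one_iff[OF assms(3)] by (intro bexI[of _ "f a"]) auto
  then show ?thesis using assms by (simp add: rank_one_groups_def)
qed

section \<open>Pure indecomposable subgroups of homogeneous completely decomposable groups\<close>

text \<open>A nontrivial \<open>c\<close> in \<open>C\<close> yields a rank-one retract of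
  \<open>H\<close> having a nonzero power in common with \<open>c\<close>. Purity pulls this retract
  into \<open>C\<close>, so it is a retract of \<open>C\<close> as well, and indecomposability
  identifies the two.\<close>

lemma indecomposable_pure_subgroup_type:
  assumes "comm_group H" "torsion_free H" "\<tau> \<in> group_types"
    and "completely_decomposable_homogeneous \<tau> H"
    and "subgroup C H" "C \<noteq> {\<one>\<^bsub>H\<^esub>}" "indecomposable (H\<lparr>carrier := C\<rparr>)"
    and pure: "\<And>x n. x \<in> carrier H \<Longrightarrow> (n::int) \<noteq> 0 \<Longrightarrow> x [^]\<^bsub>H\<^esub> n \<in> C \<Longrightarrow> x \<in> C"
  shows "H\<lparr>carrier := C\<rparr> \<in> \<tau>"
proof -
  interpret H: comm_group H by fact
  interpret C: subgroup C H by fact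
  obtain S where S: "internal_direct_sum H S (\<lambda>A. A)" "\<And>B. B \<in> S \<Longrightarrow> H\<lparr>carrier := B\<rparr> \<in> \<tau>"
    using assms(4) unfolding completely_decomposable_homogeneous_def by blast
  obtain p where p: "\<And>B. B \<in> S \<Longrightarrow> p B \<in> hom H (H\<lparr>carrier := B\<rparr>)"
    "\<And>B x. B \<in> S \<Longrightarrow> x \<in> B \<Longrightarrow> p B x = x"
    "\<And>B B' x. B \<in> S \<Longrightarrow> B' \<in> S \<Longrightarrow> B \<noteq> B' \<Longrightarrow> x \<in> B' \<Longrightarrow> p B x = \<one>\<^bsub>H\<^esub>"
    "\<And>x. x \<in> carrier H \<Longrightarrow> \<exists>F. finite F \<and> F \<subseteq> S \<and> x = (\<Otimes>\<^bsub>H\<^esub>B\<in>F. p B x)"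
    using internal_direct_sum_projections[OF assms(1) S(1)] by blast
  obtain c where c: "c \<in> C" "c \<noteq> \<one>\<^bsub>H\<^esub>" using assms(6) C.one_closed by blast
  then have cH: "c \<in> carrier H" by simp
  obtain F where F: "finite F" "F \<subseteq> S" "c = (\<Otimes>\<^bsub>H\<^esub>B\<in>F. p B c)" using p(4)[OF cH] by blast
  have "F \<noteq> {}" using F(3) c(2) by auto
  \<comment> \<open>An arbitrary summand serves as the model: all of them have type
    \<open>\<tau>\<close>, so each is the image of \<open>A\<close> under some isomorphism
    \<open>\<phi> B\<close>.\<close>
  then obtain A0 where "A0 \<in> S" using F(2) by blast
  define A where "A = H\<lparr>carrier := A0\<rparr>"
  have A\<tau>: "A \<in> \<tau>" using S(2) \<open>A0 \<in> S\<close> by (simp add: A_def)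
  then have A1: "A \<in> rank_one_groups" by (rule group_type_rank_one[OF assms(3)])
  then interpret A: comm_group A by (simp add: rank_one_groups_def)
  obtain a where a: "a \<in> carrier A" "a \<noteq> \<one>\<^bsub>A\<^esub>"
    "\<And>x. x \<in> carrier A \<Longrightarrow> \<exists>(m::int) (k::int). m \<noteq> 0 \<and> x [^]\<^bsub>A\<^esub> m = a [^]\<^bsub>A\<^esub> k"
    using A1 A.has_rank_one_iff unfolding rank_one_groups_def by blast
  have "\<exists>\<phi>. \<phi> \<in> iso A (H\<lparr>carrier := B\<rparr>)" if "B \<in> S" for B
    using group_type_iso[OF assms(3) A\<tau> S(2)[OF that]] by (auto simp: is_iso_def)
  then obtain \<phi> where \<phi>: "\<And>B. B \<in> S \<Longrightarrow> \<phi> B \<in> iso A (H\<lparr>carrier := B\<rparr>)" by metis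
  \<comment> \<open>The coordinate at \<open>B\<close>, transported back to the model group
    \<open>A\<close>.\<close>
  define \<psi> where "\<psi> B = inv_into (carrier A) (\<phi> B) \<circ> p B" for B
  have sub: "subgroup B H" if "B \<in> S" for B using S(1) that by (simp add: internal_direct_sum_def)
  have bij: "bij_betw (\<phi> B) (carrier A) B" if "B \<in> S" for B
    using \<phi>[OF that] by (simp add: iso_def)
  have \<phi>B: "\<phi> B x \<in> B" if "B \<in> S" "x \<in> carrier A" for B x
    using bij[OF that(1)] that(2) by (rule bij_betwE[THEN bspec])
  have \<phi>H: "\<phi> B \<in> hom A H" if "B \<in> S" for B
    using \<phi>[OF that] subgroup.subset[OF sub[OF that]] by (auto simp: iso_def hom_def)
  have \<psi>: "\<psi> B \<in> hom H A" if "B \<in> S" for B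
    unfolding \<psi>_def
    using p(1)[OF that] A.iso_set_sym[OF \<phi>[OF that]] by (auto simp: iso_def intro: hom_compose)
  have diag: "\<psi> B (\<phi> B x) = x" if "B \<in> S" "x \<in> carrier A" for B x
    using that p(2) \<phi>B bij_betw_inv_into_left[OF bij[OF that(1)] that(2)] by (simp add: \<psi>_def)
  have offdiag: "\<psi> B (\<phi> B' x) = \<one>\<^bsub>A\<^esub>" if "B \<in> S" "B' \<in> S" "B \<noteq> B'" "x \<in> carrier A" for B B' x
  proof -
    interpret \<phi>: group_hom A H "\<phi> B" using \<phi>H[OF that(1)] by unfold_locales
    have "inv_into (carrier A) (\<phi> B) \<one>\<^bsub>H\<^esub> = \<one>\<^bsub>A\<^esub>"
      using bij_betw_inv_into_left[OF bij[OF that(1)] A.one_closed] by simp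
    then show ?thesis using p(3)[OF that(1-3)] \<phi>B that by (simp add: \<psi>_def)
  qed
  have "\<phi> B (\<psi> B x) = p B x" if "B \<in> S" "x \<in> carrier H" for B x
    using hom_in_carrier[OF p(1)[OF that(1)] that(2)] bij[OF that(1)]
    by (simp add: \<psi>_def bij_betw_inv_into_right)
  moreover have "p B c \<in> carrier H" if "B \<in> S" for B
    using hom_in_carrier[OF p(1)[OF that] cH] subgroup.mem_carrier[OF sub[OF that]] by simp
  ultimately have "(\<Otimes>\<^bsub>H\<^esub>B\<in>F. p B c) = (\<Otimes>\<^bsub>H\<^esub>B\<in>F. \<phi> B (\<psi> B c))"
    using F(2) cH by (intro H.finprod_cong') (auto simp: subset_iff)
  then have cF: "c = (\<Otimes>\<^bsub>H\<^esub>B\<in>F. \<phi> B (\<psi> B c))" using F(3) by simp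
  have FS: "B \<in> S" if "B \<in> F" for B using F(2) that by blast
  obtain f g and M d :: int where f: "f \<in> hom A H" and g: "g \<in> hom H A"
    and gf: "\<And>x. x \<in> carrier A \<Longrightarrow> g (f x) = x" and Md: "M \<noteq> 0" "d \<noteq> 0"
    "c [^]\<^bsub>H\<^esub> M = f a [^]\<^bsub>H\<^esub> d"
    by (rule rank_one_retract_through[OF assms(1,2) A.comm_group_axioms a(1,3) F(1)
          \<phi>H[OF FS] \<psi>[OF FS] diag[OF FS] offdiag[OF FS FS] cH c(2) cF]) (assumption | rule that)+
  interpret f: group_hom A H f using f by unfold_locales
  have powC: "x [^]\<^bsub>H\<^esub> (n::int) \<in> C" if "x \<in> C" for x n
    using H.subgroup_int_pow_closed[OF assms(5) that] .
  \<comment> \<open>The power \<open>f a [^] d\<close> equals \<open>c [^] M\<close>, which lies in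
    \<open>C\<close>. The same use of purity then covers all \<open>f x\<close>, because some
    nonzero power of \<open>x\<close> is a power of \<open>a\<close>.\<close>
  have "f a \<in> C" using pure[of "f a" d] Md powC[OF c(1), of M] a(1) by simp
  have fC: "f x \<in> C" if x: "x \<in> carrier A" for x
  proof -
    obtain m k :: int where mk: "m \<noteq> 0" "x [^]\<^bsub>A\<^esub> m = a [^]\<^bsub>A\<^esub> k" using a(3)[OF x] by blast
    then have "f x [^]\<^bsub>H\<^esub> m = f a [^]\<^bsub>H\<^esub> k" using x a(1) by (simp flip: f.hom_int_pow)
    then show ?thesis using pure[of "f x" m] mk(1) powC[OF \<open>f a \<in> C\<close>] x by simp
  qed
  have "f \<in> iso A (H\<lparr>carrier := C\<rparr>)"
  proof (rule indecomposable_retract_iso)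
    show "comm_group (H\<lparr>carrier := C\<rparr>)" by (rule H.subgroup_is_comm_group) fact
    show "carrier A \<noteq> {\<one>\<^bsub>A\<^esub>}" using a by auto
    show "f \<in> hom A (H\<lparr>carrier := C\<rparr>)" using f fC by (auto simp: hom_def)
    show "g \<in> hom (H\<lparr>carrier := C\<rparr>) A" using g C.subset by (auto simp: hom_def)
  qed (use assms gf A.is_group in auto)
  moreover have "torsion_free (H\<lparr>carrier := C\<rparr>)"
    using assms(2) C.subset by (auto simp: torsion_free_def simp flip: H.nat_pow_consistent)
  ultimately have "H\<lparr>carrier := C\<rparr> \<in> rank_one_groups"
    using iso_rank_one[OF A1] H.subgroup_is_comm_group[OF assms(5)] by blast
  then show ?thesis
    using group_type_closed[OF assms(3) A\<tau>] \<open>f \<in> iso A (H\<lparr>carrier := C\<rparr>)\<close> by (auto simp: is_iso_def)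
qed

section \<open>Fully invariant summands, purity of summands, and the conclusion\<close>

lemma fully_invariant_summand_contains_indecomposable:
  fixes G (structure)
  assumes "comm_group G" "direct_summand H G" "fully_invariant H G" "H \<noteq> {\<one>\<^bsub>G\<^esub>}"
    and "internal_direct_sum G I D" "\<And>i. i \<in> I \<Longrightarrow> indecomposable (G\<lparr>carrier := D i\<rparr>)"
  obtains i where "i \<in> I" "D i \<subseteq> H"
proof -
  interpret comm_group G by fact
  obtain K where "direct_sum2 G H K" using assms(2) by (auto simp: direct_summand_def)
  then obtain r where r: "r \<in> hom G (G\<lparr>carrier := H\<rparr>)" "\<And>x. x \<in> H \<Longrightarrow> r x = x"
    using direct_sum2_projection[OF assms(1)] by blast
  obtain p where p: "\<And>i. i \<in> I \<Longrightarrow> p i \<in> hom G (G\<lparr>carrier := D i\<rparr>)"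
    "\<And>i x. i \<in> I \<Longrightarrow> x \<in> D i \<Longrightarrow> p i x = x"
    "\<And>x. x \<in> carrier G \<Longrightarrow> \<exists>F. finite F \<and> F \<subseteq> I \<and> x = (\<Otimes>i\<in>F. p i x)"
    using internal_direct_sum_projections[OF assms(1,5)] by metis
  have H: "subgroup H G" and inv: "\<And>f x. f \<in> hom G G \<Longrightarrow> x \<in> H \<Longrightarrow> f x \<in> H"
    using assms(3) by (auto simp: fully_invariant_def)
  interpret H: subgroup H G by fact
  have D: "subgroup (D i) G" if "i \<in> I" for i
    using assms(5) that by (simp add: internal_direct_sum_def)
  have pH: "p i x \<in> H" if "i \<in> I" "x \<in> H" for i x
  proof -
    \<comment> \<open>Full invariance speaks of endomorphisms of \<open>G\<close>, so the codomain
      of \<open>p i\<close> is enlarged from \<open>D i\<close> to \<open>G\<close>.\<close>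
    have "p i \<in> hom G G"
      using p(1)[OF that(1)] subgroup.subset[OF D[OF that(1)]] by (auto simp: hom_def)
    then show ?thesis using inv that(2) by blast
  qed
  have pD: "p i x \<in> D i" if "i \<in> I" "x \<in> carrier G" for i x
    using hom_in_carrier[OF p(1)[OF that(1)] that(2)] by simp
  obtain h where h: "h \<in> H" "h \<noteq> \<one>" using assms(4) H.one_closed by blast
  obtain F where F: "F \<subseteq> I" "h = (\<Otimes>i\<in>F. p i h)" using p(3)[OF H.mem_carrier[OF h(1)]] by blast
  \<comment> \<open>Otherwise \<open>h\<close> would be a product of units. By \<open>pH\<close> and
    \<open>pD\<close>, the element \<open>p i h\<close> shows that \<open>H \<inter> D i\<close> is
    nontrivial.\<close>
  then obtain i where i: "i \<in> I" "p i h \<noteq> \<one>"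
    using h(2) finprod_one_eqI[of F "\<lambda>i. p i h"] by auto
  let ?A = "G\<lparr>carrier := H \<inter> D i\<rparr>" and ?C = "G\<lparr>carrier := D i\<rparr>"
  interpret D: subgroup "D i" G using D i(1) .
  \<comment> \<open>An inclusion that is an isomorphism forces the two carriers to coincide.\<close>
  have "id \<in> iso ?A ?C"
  proof (rule indecomposable_retract_iso)
    show "comm_group ?C" using subgroup_is_comm_group D[OF i(1)] .
    show "indecomposable ?C" using assms(6) i(1) .
    show "group ?A" using subgroup_imp_group subgroups_Inter_pair H D[OF i(1)] by blast
    show "carrier ?A \<noteq> {\<one>\<^bsub>?A\<^esub>}" using pH[OF i(1) h(1)] pD[OF i(1)] h(1) i(2) by auto
    show "id \<in> hom ?A ?C" by (auto simp: hom_def)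
    \<comment> \<open>The order matters: \<open>r\<close> moves \<open>D i\<close> into
      \<open>H\<close>, and \<open>p i\<close> then lands in \<open>D i\<close> without leaving
      \<open>H\<close>.\<close>
    show "p i \<circ> r \<in> hom ?C ?A"
    proof (rule homI)
      have rH: "r x \<in> H" if "x \<in> D i" for x
        using hom_in_carrier[OF r(1)] that by fastforce
      fix x assume x: "x \<in> carrier ?C"
      show "(p i \<circ> r) x \<in> carrier ?A" using x rH pH pD i(1) by auto
      fix y assume y: "y \<in> carrier ?C"
      have "r (x \<otimes> y) = r x \<otimes> r y" using hom_mult[OF r(1)] x y by fastforce
      moreover have "p i (r x \<otimes> r y) = p i (r x) \<otimes> p i (r y)"
        using hom_mult[OF p(1)[OF i(1)], of "r x" "r y"] x y rH by simp
      ultimately show "(p i \<circ> r) (x \<otimes>\<^bsub>?C\<^esub> y) = (p i \<circ> r) x \<otimes>\<^bsub>?A\<^esub> (p i \<circ> r) y" by simp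
    qed
    show "(p i \<circ> r) (id x) = x" if "x \<in> carrier ?A" for x
      using that r(2) p(2) i(1) by auto
  qed
  then have "H \<inter> D i = D i" by (auto simp: iso_def bij_betw_def)
  then show thesis using that i(1) by blast
qed

text \<open>The power \<open>n\<close> of the \<open>B\<close>-component of \<open>x\<close> lies in
  \<open>A \<inter> B\<close>, so torsion-freeness makes that component trivial.\<close>

lemma direct_sum2_pure:
  fixes G (structure)
  assumes "comm_group G" "torsion_free G" "direct_sum2 G A B"
    and "x \<in> carrier G" "(n::int) \<noteq> 0" "x [^]\<^bsub>G\<^esub> n \<in> A"
  shows "x \<in> A"
proof -
  interpret comm_group G by fact
  have sub: "subgroup A G" "subgroup B G" and int: "A \<inter> B = {\<one>}"
    and prod: "A <#> B = carrier G"
    using assms(3) by (auto simp: direct_sum2_def)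
  interpret A: subgroup A G by fact
  interpret B: subgroup B G by fact
  obtain a b where ab: "a \<in> A" "b \<in> B" "x = a \<otimes> b"
    using assms(4) prod[symmetric] by (auto simp: set_mult_def)
  have an: "a [^] n \<in> A" and bn: "b [^] n \<in> B"
    using subgroup_int_pow_closed sub ab by auto
  have "b [^] n = inv (a [^] n) \<otimes> x [^] n"
    using ab by (simp add: int_pow_distrib flip: m_assoc)
  then have "b [^] n \<in> A" using an assms(6) by simp
  then have "b [^] n = \<one>" using bn int by blast
  then have "b = \<one>" using torsion_free_int_pow[OF assms(2) _ _ assms(5)] ab(2) by simp
  then show ?thesis using ab by simp
qed

theorem lemma4p3:
  fixes G :: "('a, 'b) monoid_scheme"
    and \<tau> :: "('a, 'b) monoid_scheme set"
    and H :: "'a set"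
  assumes "comm_group G" and "torsion_free G" and "finite_rank G"
    and "\<tau> \<in> group_types"
    and "direct_summand H G" and "fully_invariant H G"
    and "H \<noteq> {\<one>\<^bsub>G\<^esub>}"
    and "completely_decomposable_homogeneous \<tau> (G\<lparr>carrier := H\<rparr>)"
  shows "\<forall>t D. indecomposable_decomposition G t D \<longrightarrow>
           (\<exists>i\<in>{1..t}. has_rank (G\<lparr>carrier := D i\<rparr>) 1 \<and> G\<lparr>carrier := D i\<rparr> \<in> \<tau>)"
proof (intro allI impI)
  fix t D assume dec: "indecomposable_decomposition G t D"
  interpret comm_group G by fact
  have ids: "internal_direct_sum G {1..t} D"
    and ind: "\<And>i. i \<in> {1..t} \<Longrightarrow> indecomposable (G\<lparr>carrier := D i\<rparr>)"
    and nz: "\<And>i. i \<in> {1..t} \<Longrightarrow> D i \<noteq> {\<one>\<^bsub>G\<^esub>}"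
    using dec by (auto simp: indecomposable_decomposition_def)
  obtain i where i: "i \<in> {1..t}" "D i \<subseteq> H"
    using fully_invariant_summand_contains_indecomposable[OF assms(1,5-7) ids ind] by blast
  \<comment> \<open>As a summand of \<open>G\<close>, \<open>D i\<close> is pure in
    \<open>G\<close>; purity in the subgroup \<open>H\<close> follows, as powers in \<open>H\<close>
    and in \<open>G\<close> agree.\<close>
  have ds: "direct_sum2 G (D i) (generate G (\<Union>j\<in>{1..t} - {i}. D j))"
    using internal_direct_sum_direct_sum2[OF assms(1) ids i(1)] .
  have H: "subgroup H G" using assms(6) by (simp add: fully_invariant_def)
  then interpret H: subgroup H G .
  have D: "subgroup (D i) G" using ds by (simp add: direct_sum2_def)
  let ?H = "G\<lparr>carrier := H\<rparr>"
  have "?H\<lparr>carrier := D i\<rparr> \<in> \<tau>"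
  proof (rule indecomposable_pure_subgroup_type[OF _ _ assms(4,8)])
    show "comm_group ?H" using subgroup_is_comm_group[OF H] .
    show "torsion_free ?H"
      using assms(2) H.subset by (auto simp: torsion_free_def simp flip: nat_pow_consistent)
    show "subgroup (D i) ?H" using subgroup_incl[OF D H i(2)] .
    show "x \<in> D i" if "x \<in> carrier ?H" "(n::int) \<noteq> 0" "x [^]\<^bsub>?H\<^esub> n \<in> D i" for x n
      using direct_sum2_pure[OF assms(1,2) ds, of x n] that int_pow_consistent[OF H] by simp
  qed (use nz ind i in simp_all)
  then have "G\<lparr>carrier := D i\<rparr> \<in> \<tau>" by simp
  moreover from this have "has_rank (G\<lparr>carrier := D i\<rparr>) 1"
    using group_type_rank_one[OF assms(4)] by (simp add: rank_one_groups_def)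
  ultimately show "\<exists>i\<in>{1..t}. has_rank (G\<lparr>carrier := D i\<rparr>) 1 \<and> G\<lparr>carrier := D i\<rparr> \<in> \<tau>"
    using i(1) by blast
qed

end
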